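(* Let $R$ be an associative ring with unity $1$ and let $a,b\in R$. Then $a$ is $(b,b)$-polar if and only if $a$ is polar along $b$.
   Context: For $x\in R$, $\mathrm{comm}(x)=\{z\in R: xz=zx\}$, and $R^{-1}$ is the group of units of $R$. $(b,c)$-polar: for $a,b,c\in R$, $a$ is $(b,c)$-polar if there exist $p,q\in R$ such that (1) $p^2=p\in bRca$; (2) $q^2=q\in abRc$; (3) $pb=b$ and $cq=c$; (4) $cap=ca$ and $qab=ab$. (Here $bRca=\{btca:t\in R\}$, $abRc=\{abtc:t\in R\}$.) "$(b,b)$-polar" is the case $c=b$. Polar along an element (Song, Zhu, Mosić): for $a,d\in R$, $a$ is polar along $d$ if there exists $p\in R$ with $p=p^2\in\mathrm{comm}(da)$, $pd=d$ and $1+da-p\in R^{-1}$. *)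

theory Defs
  imports "HOL-Algebra.Ring"
begin

definition comm :: "('a, 'm) ring_scheme \<Rightarrow> 'a \<Rightarrow> 'a set" where
  "comm R x = {z \<in> carrier R. x \<otimes>\<^bsub>R\<^esub> z = z \<otimes>\<^bsub>R\<^esub> x}"

(* bc_polar R b c a: the element a is (b,c)-polar in R; the parameters come before the element. *)
definition bc_polar :: "('a, 'm) ring_scheme \<Rightarrow> 'a \<Rightarrow> 'a \<Rightarrow> 'a \<Rightarrow> bool" where
  "bc_polar R b c a \<longleftrightarrow>
    (\<exists>p\<in>carrier R. \<exists>q\<in>carrier R.
      p \<otimes>\<^bsub>R\<^esub> p = p \<and>
      p \<in> {b \<otimes>\<^bsub>R\<^esub> t \<otimes>\<^bsub>R\<^esub> c \<otimes>\<^bsub>R\<^esub> a | t. t \<in> carrier R} \<and>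
      q \<otimes>\<^bsub>R\<^esub> q = q \<and>
      q \<in> {a \<otimes>\<^bsub>R\<^esub> b \<otimes>\<^bsub>R\<^esub> t \<otimes>\<^bsub>R\<^esub> c | t. t \<in> carrier R} \<and>
      p \<otimes>\<^bsub>R\<^esub> b = b \<and> c \<otimes>\<^bsub>R\<^esub> q = c \<and>
      c \<otimes>\<^bsub>R\<^esub> a \<otimes>\<^bsub>R\<^esub> p = c \<otimes>\<^bsub>R\<^esub> a \<and>
      q \<otimes>\<^bsub>R\<^esub> a \<otimes>\<^bsub>R\<^esub> b = a \<otimes>\<^bsub>R\<^esub> b)"

(* polar_along R d a: the element a is polar along d in R. *)
definition polar_along :: "('a, 'm) ring_scheme \<Rightarrow> 'a \<Rightarrow> 'a \<Rightarrow> bool" where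
  "polar_along R d a \<longleftrightarrow>
    (\<exists>p\<in>carrier R.
      p = p \<otimes>\<^bsub>R\<^esub> p \<and>
      p \<in> comm R (d \<otimes>\<^bsub>R\<^esub> a) \<and>
      p \<otimes>\<^bsub>R\<^esub> d = d \<and>
      \<one>\<^bsub>R\<^esub> \<oplus>\<^bsub>R\<^esub> d \<otimes>\<^bsub>R\<^esub> a \<ominus>\<^bsub>R\<^esub> p \<in> Units R)"

end

theory Submission
  imports Defs
begin

text \<open>
  Put \<open>u = ba\<close>.  Both notions produce an idempotent \<open>p\<close> with \<open>pu = up = u\<close>, so that \<open>u\<close> lies in
  the corner ring \<open>pRp\<close>, whose unity is \<open>p\<close>.  In the Peirce decomposition with respect to \<open>p\<close> the
  element \<open>1 + u - p\<close> is block diagonal with blocks \<open>u\<close> and \<open>1 - p\<close>; hence it is a unit of \<open>R\<close> if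
  and only if \<open>u\<close> is a unit of \<open>pRp\<close> (\<open>unit_if_corner_inverse\<close>, \<open>corner_inverse_if_unit\<close>).

  If \<open>a\<close> is \<open>(b,b)\<close>-polar with \<open>p = btba\<close> and \<open>q = absb\<close>, then \<open>pb = b\<close> and \<open>bap = ba\<close> give
  \<open>pu = up = u\<close>.  A left inverse of \<open>u\<close> in the corner is \<open>btp\<close>, because \<open>btp \<cdot> ba = btba = p\<close>.  On
  the other side, \<open>b = bq = ba \<cdot> bsb\<close> shows that \<open>p = b \<cdot> tba\<close> equals \<open>ba \<cdot> bsbtba\<close>, so \<open>bsbtba\<close> is a
  right inverse.

  Conversely, if \<open>x\<close> is the inverse of \<open>u\<close> in \<open>pRp\<close>, then \<open>p = u x x u = b(axx)ba\<close> has the required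
  form, and \<open>q = axb\<close> serves as the second idempotent: \<open>bq = uxb = pb = b\<close>,
  \<open>qab = axub = apb = ab\<close>, and \<open>q = a(uxx)b = ab(axx)b\<close>.
\<close>

lemma (in ring) conjugate_cancel:
  assumes "k \<in> carrier R" "l \<in> carrier R"
  shows "k \<oplus> (l \<oplus> \<ominus> k) = l"
  using assms by (simp add: a_comm[of l] r_neg2)

lemma (in ring) unit_if_corner_inverse:
  assumes [simp]: "p \<in> carrier R" "u \<in> carrier R" "x \<in> carrier R" "y \<in> carrier R"
    and pp: "p \<otimes> p = p" and pu: "p \<otimes> u = u" and up: "u \<otimes> p = u"
    and x: "p \<otimes> x = x" "x \<otimes> p = x" "x \<otimes> u = p"
    and y: "p \<otimes> y = y" "y \<otimes> p = y" "u \<otimes> y = p"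
  shows "\<one> \<oplus> u \<ominus> p \<in> Units R"
proof -
  have "x = x \<otimes> (u \<otimes> y)"
    using x(2) y(3) by simp
  also have "\<dots> = y"
    using x(3) y(1) by (simp flip: m_assoc)
  finally have ux: "u \<otimes> x = p"
    using y(3) by simp
  \<comment> \<open>On the block belonging to \<open>1 - p\<close> the element is already the unity, so only \<open>u\<close> needs inverting.\<close>
  have "(\<one> \<oplus> x \<ominus> p) \<otimes> (\<one> \<oplus> u \<ominus> p) = \<one>"
    using pp pu up x by (simp add: a_minus_def l_distr r_distr l_minus r_minus a_assoc conjugate_cancel r_neg r_neg1)
  moreover have "(\<one> \<oplus> u \<ominus> p) \<otimes> (\<one> \<oplus> x \<ominus> p) = \<one>"
    using pp pu up x ux by (simp add: a_minus_def l_distr r_distr l_minus r_minus a_assoc conjugate_cancel r_neg r_neg1)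
  ultimately show ?thesis
    unfolding Units_def by (auto intro!: bexI[of _ "\<one> \<oplus> x \<ominus> p"])
qed

text \<open>
  With \<open>w = 1 + u - p\<close> one has \<open>wp = u = pw\<close>.  Hence the inverse of \<open>w\<close> turns \<open>u\<close> into \<open>p\<close> from either
  side, and cutting it down by \<open>p\<close> gives the inverse in the corner.
\<close>
lemma (in ring) corner_inverse_if_unit:
  assumes [simp]: "p \<in> carrier R" "u \<in> carrier R"
    and pp: "p \<otimes> p = p" and pu: "p \<otimes> u = u" and up: "u \<otimes> p = u"
    and w: "\<one> \<oplus> u \<ominus> p \<in> Units R"
  obtains x where "x \<in> carrier R" "p \<otimes> x = x" "x \<otimes> p = x" "x \<otimes> u = p" "u \<otimes> x = p"
proof -
  define w where "w = \<one> \<oplus> u \<ominus> p"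
  define v where "v = inv w"
  have wU: "w \<in> Units R" using w by (simp add: w_def)
  then have [simp]: "w \<in> carrier R" "v \<in> carrier R"
    by (simp_all add: v_def Units_closed)
  have wp: "w \<otimes> p = u"
    using pp up by (simp add: w_def a_minus_def l_distr l_minus a_assoc conjugate_cancel)
  have pw: "p \<otimes> w = u"
    using pp pu by (simp add: w_def a_minus_def r_distr r_minus a_assoc conjugate_cancel)
  have vu: "v \<otimes> u = p"
    using wU by (simp add: v_def flip: wp m_assoc)
  have uv: "u \<otimes> v = p"
    using wU by (simp add: v_def m_assoc flip: pw)
  have pv: "p \<otimes> v = v \<otimes> p"
    by (metis vu uv m_assoc \<open>u \<in> carrier R\<close> \<open>v \<in> carrier R\<close>)
  show thesis
  proof (rule that[of "v \<otimes> p"])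
    show "p \<otimes> (v \<otimes> p) = v \<otimes> p"
      using pp pv by (metis m_assoc \<open>p \<in> carrier R\<close> \<open>v \<in> carrier R\<close>)
    show "v \<otimes> p \<otimes> p = v \<otimes> p" "v \<otimes> p \<otimes> u = p"
      using pp pu vu by (simp_all add: m_assoc)
    show "u \<otimes> (v \<otimes> p) = p"
      using pp uv by (simp flip: m_assoc)
  qed simp
qed

lemma (in ring) polar_along_if_bc_polar:
  assumes [simp]: "a \<in> carrier R" "b \<in> carrier R"
    and polar: "bc_polar R b b a"
  shows "polar_along R b a"
proof -
  obtain p q t s where [simp]: "p \<in> carrier R" "t \<in> carrier R" "s \<in> carrier R"
    and pp: "p \<otimes> p = p" and p: "p = b \<otimes> t \<otimes> b \<otimes> a" and q: "q = a \<otimes> b \<otimes> s \<otimes> b"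
    and pb: "p \<otimes> b = b" and bq: "b \<otimes> q = b" and bap: "b \<otimes> a \<otimes> p = b \<otimes> a"
    using polar unfolding bc_polar_def by auto
  have pb': "p \<otimes> (b \<otimes> z) = b \<otimes> z" if "z \<in> carrier R" for z
    using pb that by (simp flip: m_assoc)
  have bap': "b \<otimes> (a \<otimes> p) = b \<otimes> a"
    using bap by (simp add: m_assoc)
  have p': "b \<otimes> (t \<otimes> (b \<otimes> a)) = p"
    by (simp add: p m_assoc)
  let ?x = "b \<otimes> t \<otimes> p" and ?y = "b \<otimes> s \<otimes> b \<otimes> t \<otimes> b \<otimes> a"
  have pu: "p \<otimes> (b \<otimes> a) = b \<otimes> a"
    by (simp add: pb')
  have "\<one> \<oplus> b \<otimes> a \<ominus> p \<in> Units R"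
  proof (rule unit_if_corner_inverse[where x = ?x and y = ?y])
    show "p \<otimes> ?x = ?x" "?x \<otimes> p = ?x" "p \<otimes> ?y = ?y" "?y \<otimes> p = ?y"
      using pp by (simp_all add: m_assoc pb' bap')
    show "?x \<otimes> (b \<otimes> a) = p"
      by (simp add: m_assoc pb' p')
    have "b \<otimes> a \<otimes> ?y = b \<otimes> q \<otimes> (t \<otimes> (b \<otimes> a))"
      by (simp add: q m_assoc)
    then show "b \<otimes> a \<otimes> ?y = p"
      by (simp add: bq p')
  qed (simp_all add: pp pu bap)
  then show ?thesis
    using pp pu pb bap unfolding polar_along_def comm_def
    by (intro bexI[of _ p]) auto
qed

lemma (in ring) bc_polar_if_polar_along:
  assumes [simp]: "a \<in> carrier R" "b \<in> carrier R"
    and polar: "polar_along R b a"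
  shows "bc_polar R b b a"
proof -
  obtain p where [simp]: "p \<in> carrier R" and pp: "p \<otimes> p = p"
    and comm: "b \<otimes> a \<otimes> p = p \<otimes> (b \<otimes> a)" and pb: "p \<otimes> b = b"
    and unit: "\<one> \<oplus> b \<otimes> a \<ominus> p \<in> Units R"
    using polar unfolding polar_along_def comm_def by auto
  have pu: "p \<otimes> (b \<otimes> a) = b \<otimes> a"
    using pb by (simp flip: m_assoc)
  have up: "b \<otimes> a \<otimes> p = b \<otimes> a"
    using comm pu by simp
  obtain x where [simp]: "x \<in> carrier R" and px: "p \<otimes> x = x" and xp: "x \<otimes> p = x"
    and xu: "x \<otimes> (b \<otimes> a) = p" and ux: "b \<otimes> a \<otimes> x = p"
    using corner_inverse_if_unit[OF _ _ pp pu up unit] by auto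
  have ux': "b \<otimes> (a \<otimes> (x \<otimes> z)) = p \<otimes> z" if "z \<in> carrier R" for z
    using that by (simp flip: ux add: m_assoc)
  have xu': "x \<otimes> (b \<otimes> (a \<otimes> z)) = p \<otimes> z" if "z \<in> carrier R" for z
    using that by (simp flip: xu add: m_assoc)
  have px': "p \<otimes> (x \<otimes> z) = x \<otimes> z" if "z \<in> carrier R" for z
    using px that by (simp flip: m_assoc)
  let ?q = "a \<otimes> x \<otimes> b" and ?t = "a \<otimes> x \<otimes> x"
  have "p = b \<otimes> ?t \<otimes> b \<otimes> a"
    using xu px pp by (simp add: m_assoc ux' px')
  moreover have "?q = a \<otimes> b \<otimes> ?t \<otimes> b"
    by (simp add: m_assoc ux' px')
  moreover have "?q \<otimes> ?q = ?q" "b \<otimes> ?q = b" "?q \<otimes> a \<otimes> b = a \<otimes> b"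
    using pb by (simp_all add: m_assoc ux' xu' px')
  moreover have "?t \<in> carrier R" "?q \<in> carrier R"
    by simp_all
  ultimately show ?thesis
    using pp pb up unfolding bc_polar_def
    by (intro bexI[of _ p] bexI[of _ ?q] conjI CollectI exI[of _ ?t]) simp_all
qed

theorem proposition2p4:
  fixes R (structure)
  assumes "ring R" and "a \<in> carrier R" and "b \<in> carrier R"
  shows "bc_polar R b b a \<longleftrightarrow> polar_along R b a"
proof -
  interpret ring R by fact
  show ?thesis
    using assms(2,3) polar_along_if_bc_polar bc_polar_if_polar_along by blast
qed

end
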